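(* Let $K\subseteq\mathbb{R}^n$ be a convex polytope and $E\subseteq\mathbb{R}^n$ a $d$-dimensional linear subspace, where $1\le d\le n-1$. Then there exists a subset $\tilde{\mathcal{F}}$ of $\mathcal{F}_d(K)$ such that for every integrable function $f\colon E\to\mathbb{R}$, $$\int_{P_EK}f(x)\,\lambda_E(dx)=\sum_{F\in\tilde{\mathcal{F}}}\frac{\mathrm{Vol}_d(P_EF)}{\mathrm{Vol}_d(F)}\int_Ff(P_Ey)\,\lambda_{\mathrm{aff}\,F}(dy).$$ In particular (for $f\equiv1$), $$\mathrm{Vol}_d(P_EK)=\sum_{F\in\tilde{\mathcal{F}}}\mathrm{Vol}_d(P_EF).$$
   Context: A polytope is the convex hull of a non-empty finite set of points (possibly with empty interior). $P_E$ is the orthogonal projection onto $E$. $\mathcal{F}_d(K)$ is the set of $d$-dimensional faces of $K$, where a face is a convex subset $F\subseteq K$ such that $x,y\in K$ and $(x+y)/2\in F$ imply $x,y\in F$ (so $K$ itself is a face), and the dimension of a convex set is the dimension of its affine hull $\mathrm{aff}$. $\lambda_G$ denotes the Lebesgue measure on an affine subspace $G$ (induced by the Euclidean structure), and $\mathrm{Vol}_d(A)=\lambda_G(A)$ for measurable $A\subseteq G$ when $\dim G=d$. *)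

theory Defs
  imports "HOL-Analysis.Analysis"
begin

definition orth_proj :: "'a::euclidean_space set \<Rightarrow> 'a \<Rightarrow> 'a" where
  "orth_proj E x = (THE y. y \<in> E \<and> x - y \<in> E\<^sup>\<bottom>)"

lemma orth_proj_ex1:
  fixes E :: "'a::euclidean_space set"
  assumes "subspace E"
  shows "\<exists>!y. y \<in> E \<and> x - y \<in> E\<^sup>\<bottom>"
proof -
  have "x \<in> E + E\<^sup>\<bottom>"
    using subspace_sum_orthogonal_comp[OF assms] by simp
  then obtain y z where yz: "y \<in> E" "z \<in> E\<^sup>\<bottom>" "x = y + z"
    by (auto elim: set_plus_elim)
  show ?thesis
  proof (rule ex1I[of _ y])
    show "y \<in> E \<and> x - y \<in> E\<^sup>\<bottom>" using yz by simp
  next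
    fix y' assume y': "y' \<in> E \<and> x - y' \<in> E\<^sup>\<bottom>"
    have 1: "y - y' \<in> E" using yz y' assms by (simp add: subspace_diff)
    have "(x - y') - (x - y) \<in> E\<^sup>\<bottom>"
      by (rule subspace_diff[OF subspace_orthogonal_comp]) (use yz y' in auto)
    then have "y - y' \<in> E\<^sup>\<bottom>" by simp
    with 1 have "orthogonal (y - y') (y - y')"
      unfolding orthogonal_comp_def by blast
    then show "y' = y" by (simp add: orthogonal_def)
  qed
qed

lemma orth_proj:
  fixes E :: "'a::euclidean_space set"
  assumes "subspace E"
  shows "orth_proj E x \<in> E" "x - orth_proj E x \<in> E\<^sup>\<bottom>"
  using theI'[OF orth_proj_ex1[OF assms, of x]] unfolding orth_proj_def by auto

definition faces_of_dim :: "nat \<Rightarrow> 'a::euclidean_space set \<Rightarrow> 'a set set" where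
  "faces_of_dim d K = {F. F face_of K \<and> aff_dim F = int d}"

text \<open>The library defines faces through open segments; for convex sets this agrees with the
  definition through midpoints.\<close>

lemma face_of_iff_midpoint:
  fixes K :: "'a::euclidean_space set"
  assumes "convex K"
  shows "F face_of K \<longleftrightarrow>
    F \<subseteq> K \<and> convex F \<and> (\<forall>x\<in>K. \<forall>y\<in>K. (1/2) *\<^sub>R (x + y) \<in> F \<longrightarrow> x \<in> F \<and> y \<in> F)"
    (is "_ \<longleftrightarrow> ?R")
proof
  assume F: "F face_of K"
  have "x \<in> F \<and> y \<in> F" if "x \<in> K" "y \<in> K" "(1/2) *\<^sub>R (x + y) \<in> F" for x y
  proof (cases "x = y")
    case True
    then show ?thesis using that by (simp add: scaleR_2[symmetric])
  next
    case False
    then have "(1/2) *\<^sub>R (x + y) \<in> open_segment x y"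
      unfolding in_segment by (auto simp: scaleR_add_right intro!: exI[of _ "1/2"])
    then show ?thesis using F that unfolding face_of_def by blast
  qed
  then show ?R using F unfolding face_of_def by blast
next
  assume R: ?R
  have K: "(1 - u) *\<^sub>R a + u *\<^sub>R b \<in> K" if "a \<in> K" "b \<in> K" "0 \<le> u" "u \<le> 1" for a b and u :: real
    using assms that by (simp add: convex_alt)
  have mid: "x \<in> F \<and> y \<in> F" if "x \<in> K" "y \<in> K" "(1/2) *\<^sub>R (x + y) \<in> F" for x y
    using R that by blast
  have left: "a \<in> F" if "a \<in> K" "b \<in> K" "u \<le> 1/2" "0 < u" "(1 - u) *\<^sub>R a + u *\<^sub>R b \<in> F"
    for a b and u :: real
  proof -
    have "(1/2) *\<^sub>R (a + ((1 - 2 * u) *\<^sub>R a + (2 * u) *\<^sub>R b)) = (1 - u) *\<^sub>R a + u *\<^sub>R b"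
      by (simp add: algebra_simps flip: scaleR_add_left)
    then show ?thesis using mid[of a] K[of a b "2 * u"] that by auto
  qed
  have step: "a \<in> F" if "a \<in> K" "b \<in> K" "0 < u" "u < 1" "1 \<le> 2 ^ Suc n * (1 - u)"
    "(1 - u) *\<^sub>R a + u *\<^sub>R b \<in> F" for a b and u :: real and n
    using that
  proof (induction n arbitrary: u)
    case 0
    then show ?case using left[of a b u] by simp
  next
    case (Suc n)
    show ?case
    proof (cases "u \<le> 1/2")
      case True
      then show ?thesis using left[of a b u] Suc.prems by simp
    next
      case False
      let ?v = "2 * u - 1"
      have "(1/2) *\<^sub>R (b + ((1 - ?v) *\<^sub>R a + ?v *\<^sub>R b)) = (1 - u) *\<^sub>R a + u *\<^sub>R b"
        by (simp add: algebra_simps flip: scaleR_add_left)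
      then have "(1 - ?v) *\<^sub>R a + ?v *\<^sub>R b \<in> F"
        using mid[of b] K[of a b ?v] Suc.prems False by auto
      then show ?thesis
        using Suc.IH[of ?v] Suc.prems False by (simp add: algebra_simps)
    qed
  qed
  have ends: "a \<in> F" if "a \<in> K" "b \<in> K" "0 < u" "u < 1" "(1 - u) *\<^sub>R a + u *\<^sub>R b \<in> F"
    for a b and u :: real
  proof -
    obtain n where "inverse (1 - u) < 2 ^ n"
      using real_arch_pow[of 2 "inverse (1 - u)"] by auto
    then have "1 \<le> 2 ^ n * (1 - u)"
      using that by (simp add: field_simps)
    also have "\<dots> \<le> 2 ^ Suc n * (1 - u)" using that by simp
    finally show ?thesis using step that by blast
  qed
  have "a \<in> F \<and> b \<in> F" if "a \<in> K" "b \<in> K" "x \<in> F" "x \<in> open_segment a b" for a b x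
  proof -
    obtain u where "0 < u" "u < 1" "x = (1 - u) *\<^sub>R a + u *\<^sub>R b"
      using \<open>x \<in> open_segment a b\<close> unfolding in_segment by blast
    then show ?thesis
      using ends[of a b u] ends[of b a "1 - u"] that by (auto simp: add.commute)
  qed
  then show "F face_of K" using R unfolding face_of_def by blast
qed

definition direction :: "'a::euclidean_space set \<Rightarrow> 'a set" where
  "direction G = {x - y | x y. x \<in> G \<and> y \<in> G}"

definition orthonormal_basis :: "'a::euclidean_space set \<Rightarrow> 'a set \<Rightarrow> bool" where
  "orthonormal_basis L B \<longleftrightarrow> pairwise orthogonal B \<and> (\<forall>b\<in>B. norm b = 1) \<and> span B = L"

text \<open>Lebesgue measure on a nonempty affine subspace \<open>G\<close>, as a complete measure whose space is
  \<open>G\<close>: the product Lebesgue measure transported to \<open>G\<close> by Cartesian coordinates with respect to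
  some origin in \<open>G\<close> and some orthonormal basis of the direction space of \<open>G\<close>. By translation and
  rotation invariance the result does not depend on these choices. On a \<open>d\<close>-dimensional \<open>G\<close> this
  measure is also the \<open>d\<close>-dimensional volume.\<close>

definition lebesgue_affine :: "'a::euclidean_space set \<Rightarrow> 'a measure" where
  "lebesgue_affine G =
    (let p = (SOME p. p \<in> G);
         B = (SOME B. orthonormal_basis (direction G) B)
     in completion (distr (PiM B (\<lambda>_. lborel)) (restrict_space borel G)
          (\<lambda>c. p + (\<Sum>b\<in>B. c b *\<^sub>R b))))"

lemma space_lebesgue_affine [simp]: "space (lebesgue_affine G) = G"
  by (simp add: lebesgue_affine_def Let_def space_restrict_space)

lemma orthonormal_basis_finite:
  assumes "orthonormal_basis L B"
  shows "finite B" "independent B" "card B = dim L"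
proof -
  have "0 \<notin> B" using assms unfolding orthonormal_basis_def by force
  then show "independent B"
    using assms pairwise_orthogonal_independent unfolding orthonormal_basis_def by blast
  then show "finite B" "card B = dim L"
    using assms independent_imp_finite dim_span_eq_card_independent
    unfolding orthonormal_basis_def by metis+
qed

lemma direction_eq:
  assumes "affine G" "p \<in> G"
  shows "direction G = (\<lambda>x. x - p) ` G" "subspace (direction G)"
proof -
  have "x - y \<in> (\<lambda>x. x - p) ` G" if "x \<in> G" "y \<in> G" for x y
  proof
    show "x - y = (x - y + p) - p" by simp
    show "x - y + p \<in> G"
      using mem_affine_3_minus[OF assms(1,2) that, of 1] by (simp add: algebra_simps)
  qed
  then show eq: "direction G = (\<lambda>x. x - p) ` G"
    unfolding direction_def using assms by auto
  show "subspace (direction G)"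
    unfolding eq using affine_diffs_subspace_subtract[OF assms] .
qed

text \<open>The choices in the definition exist, and the coordinate map is measurable, so the push-forward
  is a genuine one.\<close>

lemma lebesgue_affine_choice:
  fixes G :: "'a::euclidean_space set"
  assumes "affine G" "G \<noteq> {}"
  obtains p B where "p \<in> G" "orthonormal_basis (direction G) B"
    "(\<lambda>c. p + (\<Sum>b\<in>B. c b *\<^sub>R b)) \<in> PiM B (\<lambda>_. lborel) \<rightarrow>\<^sub>M restrict_space borel G"
    "lebesgue_affine G = completion (distr (PiM B (\<lambda>_. lborel)) (restrict_space borel G)
       (\<lambda>c. p + (\<Sum>b\<in>B. c b *\<^sub>R b)))"
proof -
  define p where "p = (SOME p. p \<in> G)"
  define B where "B = (SOME B. orthonormal_basis (direction G) B)"
  have p: "p \<in> G" unfolding p_def using assms(2) by (simp add: some_in_eq)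
  obtain B0 where "orthonormal_basis (direction G) B0"
    using orthonormal_basis_subspace[OF direction_eq(2)[OF assms(1) p]]
    unfolding orthonormal_basis_def by metis
  then have B: "orthonormal_basis (direction G) B"
    unfolding B_def by (rule someI)
  have sp: "span B = (\<lambda>x. x - p) ` G"
    using B direction_eq(1)[OF assms(1) p] unfolding orthonormal_basis_def by simp
  have "p + (\<Sum>b\<in>B. c b *\<^sub>R b) \<in> G" for c
  proof -
    have "(\<Sum>b\<in>B. c b *\<^sub>R b) \<in> span B" by (intro span_sum span_scale span_base)
    then show ?thesis unfolding sp by auto
  qed
  moreover have "(\<lambda>c. p + (\<Sum>b\<in>B. c b *\<^sub>R b)) \<in> PiM B (\<lambda>_. lborel) \<rightarrow>\<^sub>M borel"
    by measurable
  ultimately have "(\<lambda>c. p + (\<Sum>b\<in>B. c b *\<^sub>R b)) \<in> PiM B (\<lambda>_. lborel) \<rightarrow>\<^sub>M restrict_space borel G"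
    by (intro measurable_restrict_space2) auto
  with p B show thesis
    by (intro that[of p B]) (auto simp: lebesgue_affine_def p_def B_def Let_def)
qed

end

theory Submission
  imports Defs
begin

text \<open>
  Write \<open>P\<close> for the orthogonal projection onto \<open>E\<close>. Minimise a generic linear functional over the
  fibres of \<open>P\<close> in \<open>K\<close>. Genericity makes the minimiser in each fibre unique, so \<open>P\<close> is injective on
  every face having a minimiser in its relative interior, and such a face consists of minimisers
  only. The selected faces are the \<open>d\<close>-dimensional ones of this kind: outside the projections of the
  faces that \<open>P\<close> maps to dimension less than \<open>d\<close>, which form a null set, every point of \<open>P K\<close> lies in
  the projection of exactly one of them.

  On the affine hull of a selected face, \<open>P\<close> is an affine bijection onto \<open>E\<close>. It maps Lebesgue measure
  to a translation-invariant measure, which by uniqueness is a constant multiple of Lebesgue measure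
  on \<open>E\<close>; the constant is the ratio of the two volumes of the face.
\<close>

subsection \<open>Translation-invariant measures on a subspace\<close>

text \<open>Invariant measures on \<open>E\<close> are modelled as Borel measures on the whole space
  concentrated on \<open>E\<close>, so that measures built from different coordinates share one
  sigma-algebra. Sigma-finiteness is there for Fubini's theorem.\<close>

locale subspace_invariant = sigma_finite_measure M
  for M :: "'a::euclidean_space measure" +
  fixes E :: "'a set"
  assumes sets_eq [measurable_cong]: "sets M = sets borel"
    and subspace: "subspace E"
    and concentrated: "AE x in M. x \<in> E"
    and distr_shift: "\<And>v. v \<in> E \<Longrightarrow> distr M borel ((+) v) = M"
begin

lemma space_eq [simp]: "space M = UNIV"
  using sets_eq_imp_space_eq[OF sets_eq] by simp

lemma nn_integral_shift:
  assumes [measurable]: "f \<in> borel_measurable borel" and "v \<in> E"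
  shows "(\<integral>\<^sup>+x. f (v + x) \<partial>M) = (\<integral>\<^sup>+x. f x \<partial>M)"
proof -
  have "(\<integral>\<^sup>+x. f x \<partial>M) = (\<integral>\<^sup>+x. f x \<partial>distr M borel ((+) v))"
    by (simp add: distr_shift \<open>v \<in> E\<close>)
  also have "\<dots> = (\<integral>\<^sup>+x. f (v + x) \<partial>M)"
    by (subst nn_integral_distr) auto
  finally show ?thesis ..
qed

end

text \<open>Both sides equal \<open>\<integral>\<integral> 1\<^sub>A(x) 1\<^sub>B(x + y) dM(y) dN(x)\<close>.\<close>

lemma invariant_measures_swap:
  fixes M N :: "'a::euclidean_space measure"
  assumes "subspace_invariant M E" "subspace_invariant N E"
    and [measurable]: "A \<in> sets borel" "B \<in> sets borel"
  shows "emeasure N A * emeasure M B = emeasure M (uminus ` A) * emeasure N B"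
proof -
  interpret M: subspace_invariant M E by fact
  interpret N: subspace_invariant N E by fact
  interpret pair_sigma_finite M N ..
  note [measurable_cong] = M.sets_eq N.sets_eq
  define a b :: "'a \<Rightarrow> ennreal" where "a = indicator A" and "b = indicator B"
  have [measurable]: "a \<in> borel_measurable borel" "b \<in> borel_measurable borel"
    by (auto simp: a_def b_def)
  have minus: "uminus ` A = uminus -` A \<inter> space borel"
    by (auto simp: image_iff) (metis minus_minus)
  have minus_sets [measurable]: "uminus ` A \<in> sets borel"
    unfolding minus by measurable
  have "emeasure N A * emeasure M B = (\<integral>\<^sup>+x. a x * (\<integral>\<^sup>+y. b y \<partial>M) \<partial>N)"
    by (simp add: a_def b_def nn_integral_multc M.sets_eq N.sets_eq)
  \<comment> \<open>Invariance covers only shifts by vectors of \<open>E\<close>. Since both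
    measures are concentrated on \<open>E\<close>, this suffices almost everywhere, here and in the
    two later substitutions.\<close>
  also have "\<dots> = (\<integral>\<^sup>+x. (\<integral>\<^sup>+y. a x * b (x + y) \<partial>M) \<partial>N)"
    by (rule nn_integral_cong_AE, rule AE_mp[OF N.concentrated])
      (auto simp: nn_integral_cmult M.nn_integral_shift)
  also have "\<dots> = (\<integral>\<^sup>+y. (\<integral>\<^sup>+x. a x * b (x + y) \<partial>N) \<partial>M)"
    by (rule Fubini') measurable
  also have "\<dots> = (\<integral>\<^sup>+y. (\<integral>\<^sup>+x. a (x - y) * b x \<partial>N) \<partial>M)"
  proof (rule nn_integral_cong_AE, rule AE_mp[OF M.concentrated], intro AE_I2 impI)
    fix y assume "y \<in> E"
    then show "(\<integral>\<^sup>+x. a x * b (x + y) \<partial>N) = (\<integral>\<^sup>+x. a (x - y) * b x \<partial>N)"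
      using N.nn_integral_shift[of "\<lambda>x. a (x - y) * b x" y] by (simp add: add.commute)
  qed
  also have "\<dots> = (\<integral>\<^sup>+x. (\<integral>\<^sup>+y. a (x - y) * b x \<partial>M) \<partial>N)"
    by (rule Fubini'[symmetric]) measurable
  \<comment> \<open>Replacing \<open>y\<close> by \<open>x + y\<close> turns
    \<open>a (x - y)\<close> into \<open>a (- y)\<close>, which decouples the two variables.\<close>
  also have "\<dots> = (\<integral>\<^sup>+x. (\<integral>\<^sup>+y. a (- y) \<partial>M) * b x \<partial>N)"
  proof (rule nn_integral_cong_AE, rule AE_mp[OF N.concentrated], intro AE_I2 impI)
    fix x assume "x \<in> E"
    then show "(\<integral>\<^sup>+y. a (x - y) * b x \<partial>M) = (\<integral>\<^sup>+y. a (- y) \<partial>M) * b x"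
      using M.nn_integral_shift[of "\<lambda>y. a (x - y)" x] by (simp add: nn_integral_multc)
  qed
  also have "(\<integral>\<^sup>+y. a (- y) \<partial>M) = (\<integral>\<^sup>+y. indicator (uminus ` A) y \<partial>M)"
    unfolding a_def by (rule nn_integral_cong) (auto simp: indicator_def minus)
  finally show ?thesis
    by (simp add: b_def nn_integral_cmult M.sets_eq N.sets_eq)
qed

text \<open>Swapping \<open>M\<close> with itself shows that \<open>M\<close> is symmetric under
  negation, as the factor \<open>emeasure M X\<close> cancels. Swapping \<open>M\<close> with
  \<open>N\<close> then gives the constant as the quotient of the measures of \<open>X\<close>. The
  set \<open>Y\<close> excludes the values 0 and infinity for it.\<close>

lemma invariant_measures_proportional:
  fixes M N :: "'a::euclidean_space measure"
  assumes M: "subspace_invariant M E" and N: "subspace_invariant N E"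
    and X: "X \<in> sets borel" "0 < emeasure M X" "emeasure M X < \<infinity>"
    and Y: "Y \<in> sets borel" "0 < emeasure N Y" "emeasure N Y < \<infinity>"
  obtains k :: real where "0 < k" "N = density M (\<lambda>_. ennreal k)"
proof -
  interpret M: subspace_invariant M E by fact
  interpret N: subspace_invariant N E by fact
  have sym: "emeasure M (uminus ` A) = emeasure M A" if A: "A \<in> sets borel" for A
    using invariant_measures_swap[OF M M A X(1)] X by (auto simp: mult.commute[of _ "emeasure M X"] ennreal_mult_cancel_left)
  have swap: "emeasure N A * emeasure M X = emeasure M A * emeasure N X" if "A \<in> sets borel" for A
    using invariant_measures_swap[OF M N that X(1)] sym[OF that] by simp
  define k where "k = emeasure N X / emeasure M X"
  have eq: "emeasure N A = k * emeasure M A" if "A \<in> sets borel" for A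
  proof -
    have "emeasure N A = emeasure N A * emeasure M X / emeasure M X"
      using X by (simp add: ennreal_mult_divide_eq)
    also have "\<dots> = k * emeasure M A"
      unfolding swap[OF that] k_def by (simp add: ennreal_times_divide mult.commute)
    finally show ?thesis .
  qed
  have "k \<noteq> 0" using eq[OF Y(1)] Y by auto
  moreover have "k \<noteq> \<infinity>" using eq[OF Y(1)] Y
    by (auto simp: ennreal_top_mult split: if_splits)
  ultimately obtain r where r: "k = ennreal r" "0 < r"
    by (cases k) (auto simp: less_le)
  have "N = density M (\<lambda>_. ennreal r)"
    by (rule measure_eqI) (auto simp: M.sets_eq N.sets_eq emeasure_density_const eq r)
  then show thesis using that r by blast
qed

text \<open>A line in direction \<open>a\<close> meets the hyperplane in a single point, so
  integrating over all shifts \<open>t *\<^sub>R a\<close> first gives 0. By invariance the same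
  double integral is the measure of the hyperplane times infinity.\<close>

lemma (in subspace_invariant) emeasure_hyperplane:
  assumes "a \<in> E" "a \<noteq> 0"
  shows "emeasure M {x. a \<bullet> x = \<beta>} = 0"
proof -
  interpret pair_sigma_finite M "lborel :: real measure" ..
  define h :: "'a \<Rightarrow> ennreal" where "h = indicator {x. a \<bullet> x = \<beta>}"
  have [measurable]: "h \<in> borel_measurable borel" unfolding h_def by measurable
  have "(\<integral>\<^sup>+t. (\<integral>\<^sup>+x. h (t *\<^sub>R a + x) \<partial>M) \<partial>lborel) = (\<integral>\<^sup>+x. (\<integral>\<^sup>+t. h (t *\<^sub>R a + x) \<partial>lborel) \<partial>M)"
    by (rule Fubini') measurable
  also have "\<dots> = (\<integral>\<^sup>+x. (\<integral>\<^sup>+t. indicator {(\<beta> - a \<bullet> x) / (a \<bullet> a)} t \<partial>lborel) \<partial>M)"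
    using \<open>a \<noteq> 0\<close>
    by (intro nn_integral_cong) (auto simp: h_def indicator_def inner_simps field_simps)
  also have "\<dots> = 0" by simp
  also have "(\<integral>\<^sup>+t. (\<integral>\<^sup>+x. h (t *\<^sub>R a + x) \<partial>M) \<partial>(lborel :: real measure)) = (\<integral>\<^sup>+t. (\<integral>\<^sup>+x. h x \<partial>M) \<partial>(lborel :: real measure))"
    using \<open>a \<in> E\<close> subspace by (intro nn_integral_cong nn_integral_shift) (auto simp: subspace_scale)
  also have "\<dots> = emeasure M {x. a \<bullet> x = \<beta>} * \<infinity>"
    by (simp add: h_def sets_eq)
  finally show ?thesis by (auto simp: ennreal_mult_eq_top_iff)
qed

text \<open>For an orthonormal family this is Lebesgue measure on the affine subspace through
  \<open>p\<close> spanned by \<open>v\<close>, extended to the whole space. General families are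
  allowed because linear images of such measures then have the same form.\<close>

definition coord_measure :: "'a::euclidean_space \<Rightarrow> 'i set \<Rightarrow> ('i \<Rightarrow> 'a) \<Rightarrow> 'a measure" where
  "coord_measure p I v = distr (PiM I (\<lambda>_. lborel)) borel (\<lambda>c. p + (\<Sum>i\<in>I. c i *\<^sub>R v i))"

lemma sets_coord_measure [simp, measurable_cong]: "sets (coord_measure p I v) = sets borel"
  and space_coord_measure [simp]: "space (coord_measure p I v) = UNIV"
  by (simp_all add: coord_measure_def)

lemma coord_map_measurable [measurable]:
  fixes v :: "'i \<Rightarrow> 'a::euclidean_space"
  shows "(\<lambda>c. p + (\<Sum>i\<in>I. c i *\<^sub>R v i)) \<in> PiM I (\<lambda>_. lborel) \<rightarrow>\<^sub>M borel"
  by measurable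

text \<open>Boxes determine the product measure, and each factor is translation invariant.
  Restricting to \<open>I\<close> keeps the shifted function extensional, as the space of
  \<open>PiM\<close> demands.\<close>

lemma distr_PiM_shift:
  fixes w :: "'i \<Rightarrow> real"
  assumes "finite I"
  shows "distr (PiM I (\<lambda>_. lborel)) (PiM I (\<lambda>_. lborel)) (\<lambda>c. \<lambda>i\<in>I. w i + c i) = PiM I (\<lambda>_. lborel)"
proof -
  interpret product_sigma_finite "\<lambda>_::'i. lborel :: real measure" ..
  have [measurable]: "(\<lambda>c. \<lambda>i\<in>I. w i + c i) \<in> PiM I (\<lambda>_. lborel) \<rightarrow>\<^sub>M PiM I (\<lambda>_. lborel)"
    by measurable
  show ?thesis
  proof (rule PiM_eqI[OF assms])
    fix A :: "'i \<Rightarrow> real set" assume A: "\<And>i. i \<in> I \<Longrightarrow> A i \<in> sets lborel"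
    have pre: "(+) (w i) -` A i \<in> sets lborel" if "i \<in> I" for i
      using measurable_sets[of "(+) (w i)" borel borel "A i"] A[OF that] by simp
    have "(\<lambda>c. \<lambda>i\<in>I. w i + c i) -` Pi\<^sub>E I A \<inter> space (PiM I (\<lambda>_. lborel)) =
        (\<Pi>\<^sub>E i\<in>I. (+) (w i) -` A i)"
      by (auto simp: space_PiM PiE_iff)
    then have "emeasure (distr (PiM I (\<lambda>_. lborel)) (PiM I (\<lambda>_. lborel)) (\<lambda>c. \<lambda>i\<in>I. w i + c i)) (Pi\<^sub>E I A) =
        emeasure (PiM I (\<lambda>_. lborel)) (\<Pi>\<^sub>E i\<in>I. (+) (w i) -` A i)"
      using A assms by (subst emeasure_distr) (auto intro!: sets_PiM_I_finite)
    also have "\<dots> = (\<Prod>i\<in>I. emeasure lborel ((+) (w i) -` A i))"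
      using pre by (rule emeasure_PiM[OF assms])
    also have "\<dots> = (\<Prod>i\<in>I. emeasure lborel (A i))"
    proof (rule prod.cong[OF refl])
      fix i assume "i \<in> I"
      have "emeasure lborel (A i) = emeasure (distr lborel borel ((+) (w i))) (A i)"
        by (simp only: lborel_distr_plus)
      then show "emeasure lborel ((+) (w i) -` A i) = emeasure lborel (A i)"
        using A[OF \<open>i \<in> I\<close>] by (simp add: emeasure_distr)
    qed
    finally show "emeasure (distr (PiM I (\<lambda>_. lborel)) (PiM I (\<lambda>_. lborel)) (\<lambda>c. \<lambda>i\<in>I. w i + c i)) (Pi\<^sub>E I A) =
        (\<Prod>i\<in>I. emeasure lborel (A i))" .
  qed simp
qed

text \<open>A shift by a vector of the span is a shift of the coordinates by its coefficients;
  injectivity of \<open>v\<close> lets these be indexed by \<open>I\<close>.\<close>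

lemma coord_measure_shift:
  assumes "finite I" "inj_on v I" "x \<in> span (v ` I)"
  shows "distr (coord_measure p I v) borel ((+) x) = coord_measure p I v"
proof -
  obtain w where w: "x = (\<Sum>i\<in>I. w i *\<^sub>R v i)"
  proof -
    obtain u where "x = (\<Sum>a\<in>v ` I. u a *\<^sub>R a)"
      using assms by (auto simp: span_finite)
    then show thesis
      using assms by (intro that[of "u \<circ> v"]) (simp add: sum.reindex)
  qed
  have "coord_measure p I v = distr (distr (PiM I (\<lambda>_. lborel)) (PiM I (\<lambda>_. lborel)) (\<lambda>c. \<lambda>i\<in>I. w i + c i))
      borel (\<lambda>c. p + (\<Sum>i\<in>I. c i *\<^sub>R v i))"
    unfolding coord_measure_def by (simp add: distr_PiM_shift assms)
  also have "\<dots> = distr (PiM I (\<lambda>_. lborel)) borel (\<lambda>c. x + (p + (\<Sum>i\<in>I. c i *\<^sub>R v i)))"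
    by (subst distr_distr)
      (auto intro!: distr_cong simp: w comp_def scaleR_add_left sum.distrib algebra_simps)
  also have "\<dots> = distr (coord_measure p I v) borel ((+) x)"
    unfolding coord_measure_def by (subst distr_distr) (auto simp: comp_def)
  finally show ?thesis ..
qed


text \<open>The dual functionals of the independent family, extended to the whole space; they read
  off coordinates.\<close>

lemma coord_functionals:
  fixes v :: "'i \<Rightarrow> 'a::euclidean_space"
  assumes "inj_on v I" "independent (v ` I)"
  obtains L :: "'i \<Rightarrow> 'a \<Rightarrow> real" where "\<And>i. linear (L i)"
    "\<And>i j. i \<in> I \<Longrightarrow> j \<in> I \<Longrightarrow> L i (v j) = (if i = j then 1 else 0)"
proof -
  have "\<exists>g. linear g \<and> (\<forall>x\<in>v ` I. g x = (if x = v i then 1 else 0 :: real))" for i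
    using linear_independent_extend[OF assms(2)] .
  then obtain L where "\<And>i. linear (L i)"
    "\<And>i x. x \<in> v ` I \<Longrightarrow> L i x = (if x = v i then 1 else 0 :: real)"
    by metis
  then show thesis
    using assms(1) by (intro that[of L]) (auto dest: inj_onD)
qed

text \<open>The functionals recover the coordinates, so the preimage under the coordinate map is a
  cube of side \<open>2 * r\<close>. Such boxes supply the sets of positive finite measure and bound
  the measure of bounded sets.\<close>

lemma emeasure_coord_box:
  fixes v :: "'i \<Rightarrow> 'a::euclidean_space" and L :: "'i \<Rightarrow> 'a \<Rightarrow> real"
  assumes "finite I" and L: "\<And>i. linear (L i)"
    "\<And>i j. i \<in> I \<Longrightarrow> j \<in> I \<Longrightarrow> L i (v j) = (if i = j then 1 else 0)"
    and "0 \<le> r"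
  shows "{x. \<forall>i\<in>I. \<bar>L i (x - p)\<bar> \<le> r} \<in> sets borel"
    and "emeasure (coord_measure p I v) {x. \<forall>i\<in>I. \<bar>L i (x - p)\<bar> \<le> r} = ennreal ((2 * r) ^ card I)"
proof -
  interpret product_sigma_finite "\<lambda>_::'i. lborel :: real measure" ..
  have [measurable]: "L i \<in> borel_measurable borel" for i
    using L(1) by (intro borel_measurable_continuous_onI) (simp add: linear_continuous_on linear_linear)
  show [measurable]: "{x. \<forall>i\<in>I. \<bar>L i (x - p)\<bar> \<le> r} \<in> sets borel"
    using \<open>finite I\<close> by measurable
  have coord: "L i (\<Sum>j\<in>I. c j *\<^sub>R v j) = c i" if "i \<in> I" for i c
    using that \<open>finite I\<close>
    by (simp add: linear_sum[OF L(1)] linear_scale[OF L(1)] L(2) if_distrib cong: if_cong sum.cong)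
  have abs_le: "\<bar>t\<bar> \<le> r \<longleftrightarrow> t \<in> {-r..r}" for t by auto
  have "(\<lambda>c. p + (\<Sum>i\<in>I. c i *\<^sub>R v i)) -` {x. \<forall>i\<in>I. \<bar>L i (x - p)\<bar> \<le> r} \<inter> space (PiM I (\<lambda>_. lborel)) =
      (\<Pi>\<^sub>E i\<in>I. {-r..r})"
    by (auto simp: space_PiM coord PiE_iff abs_le)
  then have "emeasure (coord_measure p I v) {x. \<forall>i\<in>I. \<bar>L i (x - p)\<bar> \<le> r} =
      emeasure (PiM I (\<lambda>_. lborel)) (\<Pi>\<^sub>E i\<in>I. {-r..r})"
    unfolding coord_measure_def by (subst emeasure_distr) auto
  also have "\<dots> = ennreal ((2 * r) ^ card I)"
    using \<open>0 \<le> r\<close> by (subst emeasure_PiM) (auto simp: \<open>finite I\<close> prod_ennreal ennreal_power)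
  finally show "emeasure (coord_measure p I v) {x. \<forall>i\<in>I. \<bar>L i (x - p)\<bar> \<le> r} = ennreal ((2 * r) ^ card I)" .
qed

lemma emeasure_coord_measure_bounded:
  fixes v :: "'i \<Rightarrow> 'a::euclidean_space"
  assumes "finite I" "inj_on v I" "independent (v ` I)" "bounded A"
  shows "emeasure (coord_measure p I v) A < \<infinity>"
proof -
  obtain L :: "'i \<Rightarrow> 'a \<Rightarrow> real" where L: "\<And>i. linear (L i)"
    "\<And>i j. i \<in> I \<Longrightarrow> j \<in> I \<Longrightarrow> L i (v j) = (if i = j then 1 else 0)"
    using coord_functionals[OF assms(2,3)] by blast
  have "bounded (\<Union>i\<in>I. (\<lambda>x. L i (x - p)) ` A)"
    using assms(1,4) L(1)
    by (auto intro!: bounded_linear_image[of "(\<lambda>x. x - p) ` A", unfolded image_image]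
        bounded_translation_minus simp: linear_linear)
  then obtain r where r: "\<And>i x. i \<in> I \<Longrightarrow> x \<in> A \<Longrightarrow> \<bar>L i (x - p)\<bar> \<le> r"
    by (auto simp: bounded_iff)
  \<comment> \<open>The bound \<open>r\<close> may be negative when \<open>A\<close> or
    \<open>I\<close> is empty, hence \<open>max 0 r\<close>.\<close>
  have "emeasure (coord_measure p I v) A \<le> emeasure (coord_measure p I v) {x. \<forall>i\<in>I. \<bar>L i (x - p)\<bar> \<le> max 0 r}"
    using emeasure_coord_box(1)[OF assms(1) L, of "max 0 r" p] r
    by (intro emeasure_mono) (auto intro: le_max_iff_disj[THEN iffD2])
  also have "\<dots> < \<infinity>"
    using emeasure_coord_box(2)[OF assms(1) L, of "max 0 r" p] by simp
  finally show ?thesis .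
qed

lemma coord_measure_positive:
  fixes v :: "'i \<Rightarrow> 'a::euclidean_space"
  assumes "finite I" "inj_on v I" "independent (v ` I)"
  obtains X where "X \<in> sets borel" "0 < emeasure (coord_measure p I v) X"
    "emeasure (coord_measure p I v) X < \<infinity>"
proof -
  obtain L :: "'i \<Rightarrow> 'a \<Rightarrow> real" where L: "\<And>i. linear (L i)"
    "\<And>i j. i \<in> I \<Longrightarrow> j \<in> I \<Longrightarrow> L i (v j) = (if i = j then 1 else 0)"
    using coord_functionals[OF assms(2,3)] by blast
  show thesis
    using emeasure_coord_box[OF assms(1) L, of 1 p] by (intro that) auto
qed

text \<open>Balls have finite measure, which gives sigma-finiteness; a base point inside the span
  keeps the whole image of the coordinate map there.\<close>

lemma subspace_invariant_coord_measure:
  fixes v :: "'i \<Rightarrow> 'a::euclidean_space"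
  assumes "finite I" "inj_on v I" "independent (v ` I)" "p \<in> span (v ` I)"
  shows "subspace_invariant (coord_measure p I v) (span (v ` I))"
proof (intro subspace_invariant.intro subspace_invariant_axioms.intro)
  let ?M = "coord_measure p I v"
  show "sigma_finite_measure ?M"
  proof
    show "\<exists>A. countable A \<and> A \<subseteq> sets ?M \<and> \<Union> A = space ?M \<and> (\<forall>a\<in>A. emeasure ?M a \<noteq> \<infinity>)"
    proof (intro exI[of _ "range (\<lambda>n. cball 0 (real n))"] conjI ballI)
      show "\<Union> (range (\<lambda>n. cball 0 (real n))) = space ?M"
        by (auto simp: real_arch_simple)
      show "emeasure ?M a \<noteq> \<infinity>" if "a \<in> range (\<lambda>n. cball 0 (real n))" for a
        using that emeasure_coord_measure_bounded[OF assms(1-3), of a p] by auto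
    qed auto
  qed
  show "AE x in ?M. x \<in> span (v ` I)"
    unfolding coord_measure_def
  proof (subst AE_distr_iff)
    show "AE c in PiM I (\<lambda>_. lborel). p + (\<Sum>i\<in>I. c i *\<^sub>R v i) \<in> span (v ` I)"
      using assms(4) by (intro AE_I2 span_add span_sum span_scale) (auto intro: span_base)
  qed (auto simp: closed_subspace)
qed (auto intro: coord_measure_shift assms)

subsection \<open>Selecting faces by a generic functional\<close>

text \<open>Take a face of least dimension containing \<open>y\<close>. The relative interior of a
  polyhedron is what remains after removing its facets, and a facet through \<open>y\<close> would
  be a smaller face.\<close>

lemma polyhedron_face_rel_interior:
  fixes K :: "'a::euclidean_space set"
  assumes "polyhedron K" "y \<in> K"
  obtains F where "F face_of K" "y \<in> rel_interior F"
proof -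
  have "K face_of K" using assms by (simp add: face_of_refl polyhedron_imp_convex)
  \<comment> \<open>Since \<open>aff_dim\<close> can be -1, one is added before applying
    \<open>nat\<close>, so that the order of dimensions is kept.\<close>
  then obtain F where F: "F face_of K" "y \<in> F"
    and min: "\<And>G. G face_of K \<Longrightarrow> y \<in> G \<Longrightarrow> nat (aff_dim F + 1) \<le> nat (aff_dim G + 1)"
    using ex_has_least_nat[of "\<lambda>F. F face_of K \<and> y \<in> F" K "\<lambda>F. nat (aff_dim F + 1)"] assms(2) by blast
  have "y \<notin> C" if "C facet_of F" for C
  proof
    assume "y \<in> C"
    have "C face_of K" using that F(1) face_of_trans facet_of_imp_face_of by blast
    with min[OF this \<open>y \<in> C\<close>] that aff_dim_geq[of C] show False
      by (auto simp: facet_of_def)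
  qed
  then have "y \<in> rel_interior F"
    using F rel_interior_of_polyhedron[OF face_of_polyhedron_polyhedron[OF assms(1) F(1)]] by auto
  with F show thesis using that by blast
qed

text \<open>Finitely many hyperplanes form a negligible set and cannot cover the space.\<close>

lemma exists_inner_nonzero:
  fixes S :: "'a::euclidean_space set"
  assumes "finite S" "0 \<notin> S"
  obtains u where "\<And>w. w \<in> S \<Longrightarrow> u \<bullet> w \<noteq> 0"
proof -
  have "negligible (\<Union>w\<in>S. {u. w \<bullet> u = 0})"
    using assms by (intro negligible_Union) (auto intro!: negligible_hyperplane)
  then have "(\<Union>w\<in>S. {u. w \<bullet> u = 0}) \<noteq> UNIV"
    using open_not_negligible[of UNIV] by auto
  then obtain u where "\<And>w. w \<in> S \<Longrightarrow> w \<bullet> u \<noteq> 0" by auto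
  then show thesis using that[of u] by (auto simp: inner_commute)
qed

lemma direction_rel_interior:
  fixes F :: "'a::euclidean_space set"
  assumes "y \<in> rel_interior F" "v \<in> direction (affine hull F)"
  obtains e where "0 < e" "y + e *\<^sub>R v \<in> F" "y - e *\<^sub>R v \<in> F"
proof -
  obtain r where r: "y \<in> F" "0 < r" "ball y r \<inter> affine hull F \<subseteq> F"
    using assms(1) by (auto simp: mem_rel_interior_ball)
  have y: "y \<in> affine hull F" using r(1) by (rule hull_inc)
  \<comment> \<open>The summand 1 keeps the denominator positive when \<open>v\<close> is
    zero.\<close>
  define e where "e = r / (2 * (norm v + 1))"
  have e: "0 < e" using r(2) by (auto simp: e_def intro!: divide_pos_pos add_nonneg_pos)
  have "e * norm v < r"
  proof -
    have "e * norm v < e * (2 * (norm v + 1))"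
      using e by (intro mult_strict_left_mono) (auto simp: add_strict_increasing2)
    also have "\<dots> = r" by (simp add: e_def add_nonneg_eq_0_iff)
    finally show ?thesis .
  qed
  moreover have "y + t *\<^sub>R v \<in> affine hull F" for t
  proof -
    have "t *\<^sub>R v \<in> direction (affine hull F)"
      by (rule subspace_scale[OF direction_eq(2)[OF affine_affine_hull y] assms(2)])
    then show ?thesis
      unfolding direction_eq(1)[OF affine_affine_hull y] by auto
  qed
  from this[of e] this[of "-e"] have "y + e *\<^sub>R v \<in> affine hull F" "y - e *\<^sub>R v \<in> affine hull F"
    by simp_all
  ultimately show thesis
    using e r(3) by (intro that[of e]) (auto simp: dist_norm subset_iff)
qed

lemma aff_dim_direction:
  fixes F :: "'a::euclidean_space set"
  assumes "F \<noteq> {}"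
  shows "aff_dim F = int (dim (direction (affine hull F)))"
proof -
  obtain y where y: "y \<in> affine hull F" using \<open>F \<noteq> {}\<close> by (meson ex_in_conv hull_inc)
  then show ?thesis
    using aff_dim_eq_dim_subtract[of y "affine hull F"]
    by (simp add: direction_eq(1)[OF affine_affine_hull y] hull_hull)
qed

lemma aff_dim_le_dim_range:
  fixes F :: "'a::euclidean_space set" and P :: "'a \<Rightarrow> 'b::euclidean_space"
  assumes "linear P" "range P \<subseteq> E" and "F \<noteq> {}"
    and inj: "\<And>v. v \<in> direction (affine hull F) \<Longrightarrow> P v = 0 \<Longrightarrow> v = 0"
  shows "aff_dim F \<le> int (dim E)"
proof -
  obtain y where y: "y \<in> affine hull F" using \<open>F \<noteq> {}\<close> by (meson ex_in_conv hull_inc)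
  have sub: "subspace (direction (affine hull F))"
    using direction_eq(2)[OF affine_affine_hull y] .
  then have "inj_on P (span (direction (affine hull F)))"
    unfolding span_eq_iff[THEN iffD2, OF sub] using inj
    by (intro inj_onI) (metis assms(1) eq_iff_diff_eq_0 linear_diff subspace_diff)
  then have "dim (direction (affine hull F)) = dim (P ` direction (affine hull F))"
    using assms(1) by (simp add: dim_image_eq)
  also have "\<dots> \<le> dim E"
    using assms(2) by (intro dim_subset) auto
  finally show ?thesis using aff_dim_direction[OF \<open>F \<noteq> {}\<close>] by simp
qed

text \<open>Every fibre over a point of the projection has a minimiser of a generic functional by
  compactness. The face around it has dimension at most \<open>dim E\<close> by injectivity, and at
  least \<open>dim E\<close> outside the exceptional set.\<close>

lemma polytope_section_faces:
  fixes K :: "'a::euclidean_space set" and P :: "'a \<Rightarrow> 'b::euclidean_space"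
  assumes "polytope K" "linear P" "range P \<subseteq> E"
  obtains \<F> where "\<F> \<subseteq> faces_of_dim (dim E) K"
    "\<And>F v. F \<in> \<F> \<Longrightarrow> v \<in> direction (affine hull F) \<Longrightarrow> P v = 0 \<Longrightarrow> v = 0"
    "\<And>x. x \<in> P ` K \<Longrightarrow> x \<notin> (\<Union>G\<in>{G. G face_of K \<and> aff_dim (P ` G) < int (dim E)}. P ` G) \<Longrightarrow>
      \<exists>!F. F \<in> \<F> \<and> x \<in> P ` F"
proof -
  interpret P: linear P by fact
  let ?D = "\<lambda>F. direction (affine hull F)"
  have K: "compact K" "convex K" "polyhedron K"
    using assms(1) by (simp_all add: polytope_imp_compact polytope_imp_convex polytope_imp_polyhedron)
  define bad where "bad F \<longleftrightarrow> (\<exists>v\<in>?D F. P v = 0 \<and> v \<noteq> 0)" for F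
  \<comment> \<open>One kernel direction for each bad face is enough. As there are finitely many
    faces, a generic \<open>u\<close> is orthogonal to none of them.\<close>
  obtain w where w: "\<And>F. bad F \<Longrightarrow> w F \<in> ?D F \<and> P (w F) = 0 \<and> w F \<noteq> 0"
  proof -
    have "\<forall>F. \<exists>v. bad F \<longrightarrow> v \<in> ?D F \<and> P v = 0 \<and> v \<noteq> 0"
      unfolding bad_def by blast
    from choice[OF this] that show thesis by blast
  qed
  have "finite (w ` {F. F face_of K \<and> bad F})"
    using finite_polytope_faces[OF assms(1)] by (simp add: finite_subset[of "{F. F face_of K \<and> bad F}"] subset_iff)
  moreover have "0 \<notin> w ` {F. F face_of K \<and> bad F}" using w by force
  ultimately obtain u where "\<And>v. v \<in> w ` {F. F face_of K \<and> bad F} \<Longrightarrow> u \<bullet> v \<noteq> 0"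
    using exists_inner_nonzero by blast
  then have u: "\<And>F. F face_of K \<Longrightarrow> bad F \<Longrightarrow> u \<bullet> w F \<noteq> 0" by blast
  define opt where "opt y \<longleftrightarrow> y \<in> K \<and> (\<forall>z\<in>K. P z = P y \<longrightarrow> u \<bullet> y \<le> u \<bullet> z)" for y
  \<comment> \<open>Moving \<open>y\<close> slightly both ways along \<open>w F\<close> stays in the
    face and in the fibre, so minimality would force \<open>u\<close> to be orthogonal to
    \<open>w F\<close>.\<close>
  have not_bad: "\<not> bad F" if F: "F face_of K" "y \<in> rel_interior F" "opt y" for F y
  proof
    assume "bad F"
    then obtain e where e: "0 < e" "y + e *\<^sub>R w F \<in> F" "y - e *\<^sub>R w F \<in> F"
      using direction_rel_interior[OF F(2)] w by blast
    then have "y + e *\<^sub>R w F \<in> K" "y - e *\<^sub>R w F \<in> K"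
      using face_of_imp_subset[OF F(1)] by auto
    then have "u \<bullet> y \<le> u \<bullet> (y + e *\<^sub>R w F)" "u \<bullet> y \<le> u \<bullet> (y - e *\<^sub>R w F)"
      using F(3) w[OF \<open>bad F\<close>] unfolding opt_def
      by (auto simp: P.add P.diff P.scale)
    then have "e * (u \<bullet> w F) = 0" by (simp add: inner_simps)
    then show False using e(1) u[OF F(1) \<open>bad F\<close>] by simp
  qed
  \<comment> \<open>The midpoint of two minimisers in a fibre is a minimiser. The face around it
    contains both, so their difference is a kernel direction of a face that is not bad.\<close>
  have opt_unique: "y = z" if "opt y" "opt z" "P y = P z" for y z
  proof -
    let ?m = "(1/2) *\<^sub>R (y + z)"
    have uz: "u \<bullet> y = u \<bullet> z" using that by (auto simp: opt_def intro: antisym)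
    have mK: "?m \<in> K"
      using convexD[OF K(2), of y z "1/2" "1/2"] that by (simp add: opt_def scaleR_add_right)
    have "P ?m = P y" using that(3) by (simp add: P.scale P.add flip: scaleR_2)
    moreover have "u \<bullet> ?m = u \<bullet> y" using uz by (simp add: inner_simps)
    ultimately have m: "opt ?m" using mK that(1) by (auto simp: opt_def)
    obtain F where F: "F face_of K" "?m \<in> rel_interior F"
      using polyhedron_face_rel_interior[OF K(3) mK] .
    have "y \<in> F \<and> z \<in> F"
    proof -
      have "y \<in> K" "z \<in> K" using that by (auto simp: opt_def)
      moreover have "?m \<in> F" using F(2) rel_interior_subset by blast
      ultimately show ?thesis using F(1) unfolding face_of_iff_midpoint[OF K(2)] by blast
    qed
    then have "y - z \<in> ?D F" unfolding direction_def by (auto dest: hull_inc)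
    moreover have "P (y - z) = 0" using that(3) by (simp add: P.diff)
    ultimately show "y = z" using not_bad[OF F m] unfolding bad_def by auto
  qed
  \<comment> \<open>If \<open>z'\<close> beats \<open>z\<close>, extend the segment from
    \<open>z\<close> past \<open>y\<close> within \<open>F\<close> and mix its end with
    \<open>z'\<close>. A suitable weight yields \<open>y + t *\<^sub>R (z' - z)\<close>, which lies
    in the fibre of \<open>y\<close> and beats \<open>y\<close>.\<close>
  have opt_face: "opt z" if F: "F face_of K" "y \<in> rel_interior F" "opt y" "z \<in> F" for F y z
  proof (rule ccontr)
    assume "\<not> opt z"
    then obtain z' where z': "z' \<in> K" "P z' = P z" "u \<bullet> z' < u \<bullet> z"
      using F(4) face_of_imp_subset[OF F(1)] unfolding opt_def by force
    have yF: "y \<in> F" using F(2) rel_interior_subset by blast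
    then have "y - z \<in> ?D F" using F(4) unfolding direction_def by (auto dest: hull_inc)
    then obtain e where e: "0 < e" "y + e *\<^sub>R (y - z) \<in> F"
      using direction_rel_interior[OF F(2)] by blast
    \<comment> \<open>The weight solves \<open>(1 - t) * e = t\<close>, so \<open>y\<close> gets
      coefficient 1 and \<open>z\<close> gets \<open>- t\<close>.\<close>
    define t where "t = e / (1 + e)"
    let ?y' = "(1 - t) *\<^sub>R (y + e *\<^sub>R (y - z)) + t *\<^sub>R z'"
    have t: "0 < t" "t < 1" "(1 - t) * (1 + e) = 1" "(1 - t) * e = t"
      using e(1) by (auto simp: t_def field_simps)
    have "?y' = ((1 - t) * (1 + e)) *\<^sub>R y - ((1 - t) * e) *\<^sub>R z + t *\<^sub>R z'"
      by (simp add: algebra_simps)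
    then have y': "?y' = y + t *\<^sub>R (z' - z)"
      unfolding t(3,4) by (simp add: algebra_simps)
    have "?y' \<in> K"
      using convexD[OF K(2), of "y + e *\<^sub>R (y - z)" z' "1 - t" t] e(2) z'(1) t face_of_imp_subset[OF F(1)]
      by auto
    moreover have "P ?y' = P y" unfolding y' using z'(2) by (simp add: P.add P.scale P.diff)
    ultimately have "u \<bullet> y \<le> u \<bullet> ?y'" using F(3) by (auto simp: opt_def)
    then have "0 \<le> t * (u \<bullet> z' - u \<bullet> z)" unfolding y' by (simp add: inner_simps)
    then show False using t(1) z'(3) by (simp add: zero_le_mult_iff)
  qed
  define \<F> where "\<F> = {F \<in> faces_of_dim (dim E) K. \<not> bad F \<and> (\<forall>y\<in>F. opt y)}"
  show thesis
  proof (rule that[of \<F>])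
    fix x assume x: "x \<in> P ` K"
      and good: "x \<notin> (\<Union>G\<in>{G. G face_of K \<and> aff_dim (P ` G) < int (dim E)}. P ` G)"
    \<comment> \<open>A linear map does not raise dimension, so a face of smaller dimension would
      put \<open>x\<close> in the exceptional set.\<close>
    have good': "int (dim E) \<le> aff_dim G" if "G face_of K" "x \<in> P ` G" for G
      using good that aff_dim_linear_image_le[OF assms(2), of G] by force
    have "closed (P -` {x})"
      by (rule continuous_closed_vimage)
        (auto simp: linear_continuous_at linear_linear assms(2))
    then have "compact (K \<inter> P -` {x})" by (rule compact_Int_closed[OF K(1)])
    moreover have "K \<inter> P -` {x} \<noteq> {}" using x by auto
    ultimately have "\<exists>y\<in>K \<inter> P -` {x}. \<forall>z\<in>K \<inter> P -` {x}. u \<bullet> y \<le> u \<bullet> z"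
      by (rule continuous_attains_inf) (intro continuous_intros)
    then obtain y where y: "opt y" "P y = x" by (auto simp: opt_def)
    then obtain F where F: "F face_of K" "y \<in> rel_interior F"
      using polyhedron_face_rel_interior[OF K(3), of y] unfolding opt_def by blast
    have yF: "y \<in> F" using F(2) rel_interior_subset by blast
    have "aff_dim F \<le> int (dim E)"
      using aff_dim_le_dim_range[OF assms(2,3), of F] not_bad[OF F y(1)] yF unfolding bad_def by blast
    then have "F \<in> \<F>"
      using good'[OF F(1)] F y yF not_bad[OF F y(1)] opt_face[OF F y(1)]
      by (auto simp: \<F>_def faces_of_dim_def)
    \<comment> \<open>The unique minimiser \<open>y\<close> lies in both faces. Their intersection
      is a face of \<open>K\<close> whose projection contains \<open>x\<close>; were it a proper
      face of either, its dimension would fall below \<open>dim E\<close>.\<close>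
    moreover have "F' = F" if F': "F' \<in> \<F>" "x \<in> P ` F'" for F'
    proof -
      obtain y' where "y' \<in> F'" "P y' = x" using F'(2) by auto
      then have "y \<in> F'" using F'(1) opt_unique[OF y(1)] y(2) by (auto simp: \<F>_def)
      then have "x \<in> P ` (F \<inter> F')" using yF y(2) by auto
      have eq: "F \<inter> F' = H" if "H \<in> \<F>" "F \<inter> F' \<subseteq> H" for H
      proof (rule ccontr)
        have fK: "(F \<inter> F') face_of K" "H face_of K"
          using F(1) F'(1) that by (auto simp: \<F>_def faces_of_dim_def intro: face_of_Int)
        then have fH: "(F \<inter> F') face_of H" using that(2) face_of_face by blast
        assume "F \<inter> F' \<noteq> H"
        then have "aff_dim (F \<inter> F') < aff_dim H"
          using face_of_aff_dim_lt[OF _ fH] face_of_imp_convex[OF fK(2)] K(2) by blast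
        then show False
          using good'[OF fK(1) \<open>x \<in> P ` (F \<inter> F')\<close>] that(1) by (auto simp: \<F>_def faces_of_dim_def)
      qed
      show ?thesis
        using eq[OF \<open>F \<in> \<F>\<close> Int_lower1] eq[OF F'(1) Int_lower2] by simp
    qed
    moreover have "x \<in> P ` F" using yF y(2) by blast
    ultimately show "\<exists>!F. F \<in> \<F> \<and> x \<in> P ` F" by blast
  qed (auto simp: \<F>_def bad_def)
qed

subsection \<open>Lebesgue measure under projection\<close>

lemma linear_orth_proj:
  assumes "subspace E"
  shows "linear (orth_proj E)"
proof -
  have eq: "orth_proj E x = y" if "y \<in> E" "x - y \<in> E\<^sup>\<bottom>" for x y
    using orth_proj_ex1[OF assms, of x] orth_proj[OF assms, of x] that by blast
  note perp = subspace_orthogonal_comp[of E]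
  show ?thesis
  proof (rule linearI)
    fix x y
    have "(x - orth_proj E x) + (y - orth_proj E y) \<in> E\<^sup>\<bottom>"
      by (intro subspace_add perp orth_proj assms)
    then show "orth_proj E (x + y) = orth_proj E x + orth_proj E y"
      by (intro eq subspace_add orth_proj assms) (simp add: algebra_simps)
  next
    fix r x
    have "r *\<^sub>R (x - orth_proj E x) \<in> E\<^sup>\<bottom>"
      by (intro subspace_scale perp orth_proj assms)
    then show "orth_proj E (r *\<^sub>R x) = r *\<^sub>R orth_proj E x"
      by (intro eq subspace_scale orth_proj assms) (simp add: algebra_simps)
  qed
qed

text \<open>Connects the measure on the restricted sigma-algebra of \<open>G\<close> with its
  extension to the whole space.\<close>

lemma emeasure_coord_restrict:
  assumes \<phi>: "(\<lambda>c. p + (\<Sum>b\<in>B. c b *\<^sub>R b)) \<in> PiM B (\<lambda>_. lborel) \<rightarrow>\<^sub>M restrict_space borel G"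
    and "G \<in> sets borel" "A \<in> sets borel" "A \<subseteq> G"
  shows "emeasure (distr (PiM B (\<lambda>_. lborel)) (restrict_space borel G) (\<lambda>c. p + (\<Sum>b\<in>B. c b *\<^sub>R b))) A =
    emeasure (coord_measure p B (\<lambda>b. b)) A"
  using assms by (simp add: coord_measure_def emeasure_distr sets_restrict_space_iff)

lemma lebesgue_affine_coords:
  fixes G :: "'a::euclidean_space set"
  assumes "affine G" "G \<noteq> {}"
  obtains p B where "p \<in> G" "finite B" "independent B" "span B = direction G"
    "\<And>A. A \<in> sets borel \<Longrightarrow> A \<subseteq> G \<Longrightarrow>
      emeasure (lebesgue_affine G) A = emeasure (coord_measure p B (\<lambda>b. b)) A"
proof -
  obtain p B where *: "p \<in> G" "orthonormal_basis (direction G) B"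
    "(\<lambda>c. p + (\<Sum>b\<in>B. c b *\<^sub>R b)) \<in> PiM B (\<lambda>_. lborel) \<rightarrow>\<^sub>M restrict_space borel G"
    "lebesgue_affine G = completion (distr (PiM B (\<lambda>_. lborel)) (restrict_space borel G)
       (\<lambda>c. p + (\<Sum>b\<in>B. c b *\<^sub>R b)))"
    using lebesgue_affine_choice[OF assms] .
  have G: "G \<in> sets borel" using assms(1) by (intro borel_closed affine_closed)
  show thesis
  proof (rule that[OF *(1) orthonormal_basis_finite(1,2)[OF *(2)]])
    show "span B = direction G" using *(2) by (simp add: orthonormal_basis_def)
    show "emeasure (lebesgue_affine G) A = emeasure (coord_measure p B (\<lambda>b. b)) A"
      if "A \<in> sets borel" "A \<subseteq> G" for A
      unfolding *(4) using emeasure_coord_restrict[OF *(3) G that] that G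
      by (simp add: sets_restrict_space_iff)
  qed
qed

lemma sets_lebesgue_affine:
  fixes G :: "'a::euclidean_space set"
  assumes "affine G" "A \<in> sets borel" "A \<subseteq> G"
  shows "A \<in> sets (lebesgue_affine G)"
proof -
  have "G \<in> sets borel" using assms(1) by (intro borel_closed affine_closed)
  then show ?thesis
    using assms unfolding lebesgue_affine_def Let_def
    by (intro sets_completionI_sets) (simp add: sets_restrict_space_iff)
qed

lemma direction_subspace:
  assumes "subspace E"
  shows "direction E = E"
  using direction_eq(1)[OF subspace_imp_affine[OF assms] subspace_0[OF assms]] by simp

lemma emeasure_lebesgue_affine_bounded:
  fixes E :: "'a::euclidean_space set"
  assumes "subspace E" "A \<in> sets borel" "A \<subseteq> E" "bounded A"
  shows "emeasure (lebesgue_affine E) A < \<infinity>"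
proof -
  have E: "affine E" "E \<noteq> {}" using assms(1) subspace_imp_affine subspace_0 by auto
  from lebesgue_affine_coords[OF E] show ?thesis
    using emeasure_coord_measure_bounded[of _ "\<lambda>b. b"] assms by (metis image_ident inj_on_id2)
qed

text \<open>A set of too small dimension has differences spanning a proper subspace of
  \<open>E\<close>. A nonzero vector of \<open>E\<close> orthogonal to them defines a hyperplane
  that contains the set and has measure zero.\<close>

lemma null_sets_lebesgue_affine:
  fixes E :: "'a::euclidean_space set"
  assumes E: "subspace E" and A: "A \<in> sets borel" "A \<subseteq> E" "aff_dim A < int (dim E)"
  shows "A \<in> null_sets (lebesgue_affine E)"
proof (cases "A = {}")
  case False
  then obtain z where z: "z \<in> A" by auto
  let ?S = "(\<lambda>x. x - z) ` A"
  have sub: "span ?S \<subseteq> E"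
    using A(2) z E by (intro span_minimal) (auto intro: subspace_diff)
  have "dim ?S < dim E"
    using A(3) aff_dim_eq_dim_subtract[of z A] z by (simp add: hull_inc)
  then have "span ?S \<noteq> E" by (metis dim_span less_irrefl)
  with sub have "span ?S \<subset> span E" using E by (simp add: span_eq_iff[THEN iffD2])
  then obtain a where a: "a \<noteq> 0" "a \<in> E" "\<And>y. y \<in> span ?S \<Longrightarrow> orthogonal a y"
    using orthogonal_to_subspace_exists_gen span_eq_iff[THEN iffD2, OF E] by metis
  have AH: "A \<subseteq> {x. a \<bullet> x = a \<bullet> z}"
  proof
    fix x assume "x \<in> A"
    then have "orthogonal a (x - z)" by (intro a(3) span_base) auto
    then show "x \<in> {x. a \<bullet> x = a \<bullet> z}" by (simp add: orthogonal_def inner_diff_right)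
  qed
  have "affine E" "E \<noteq> {}" using E subspace_imp_affine z A(2) by auto
  from lebesgue_affine_coords[OF this] obtain p B
    where pB: "p \<in> E" "finite B" "independent B" "span B = direction E"
      "emeasure (lebesgue_affine E) A = emeasure (coord_measure p B (\<lambda>b. b)) A"
    using A(1,2) by metis
  then have "subspace_invariant (coord_measure p B (\<lambda>b. b)) E"
    using subspace_invariant_coord_measure[of B "\<lambda>b. b" p] by (simp add: direction_subspace E)
  then have "emeasure (coord_measure p B (\<lambda>b. b)) {x. a \<bullet> x = a \<bullet> z} = 0"
    using a by (intro subspace_invariant.emeasure_hyperplane)
  moreover have "emeasure (coord_measure p B (\<lambda>b. b)) A \<le>
      emeasure (coord_measure p B (\<lambda>b. b)) {x. a \<bullet> x = a \<bullet> z}"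
    using AH by (intro emeasure_mono) (auto intro!: borel_closed closed_hyperplane)
  ultimately show ?thesis
    using sets_lebesgue_affine[OF \<open>affine E\<close> A(1,2)] pB(5) by (simp add: null_sets_def)
qed simp

text \<open>A positive constant factor leaves the null sets unchanged, so push-forward and
  completion commute.\<close>

lemma completion_distr_density:
  assumes T: "T \<in> M \<rightarrow>\<^sub>M N" and eq: "distr M N T = density N (\<lambda>_. ennreal k)" and "0 < k"
  shows "T \<in> completion M \<rightarrow>\<^sub>M completion N"
    and "distr (completion M) (completion N) T = density (completion N) (\<lambda>_. ennreal k)"
proof -
  have T': "T \<in> completion M \<rightarrow>\<^sub>M N" using T by (rule measurable_completion)
  have d: "distr (completion M) N T = density N (\<lambda>_. ennreal k)"
    using distr_completion[OF T] eq by simp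
  have null: "null_sets (distr (completion M) N T) = null_sets N"
    unfolding d using \<open>0 < k\<close> by (auto simp: null_sets_def emeasure_density_const)
  show "T \<in> completion M \<rightarrow>\<^sub>M completion N"
    using T' null by (intro completion.measurable_completion2) auto
  have "distr (completion M) (completion N) T = completion (density N (\<lambda>_. ennreal k))"
    using completion.completion_distr_eq[OF T' null] d by simp
  also have "\<dots> = density (completion N) (\<lambda>_. ennreal k)"
    using \<open>0 < k\<close> by (intro completion_density_eq) auto
  finally show "distr (completion M) (completion N) T = density (completion N) (\<lambda>_. ennreal k)" .
qed

text \<open>In coordinates the image of the measure on \<open>G\<close> is
  \<open>coord_measure (P p) B P\<close>. Equality of dimensions makes the images of the basis
  vectors a basis of \<open>E\<close>, so this measure is invariant on \<open>E\<close> and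
  uniqueness applies.\<close>

lemma lebesgue_affine_linear_image:
  fixes G :: "'a::euclidean_space set" and P :: "'a \<Rightarrow> 'b::euclidean_space"
  assumes G: "affine G" "G \<noteq> {}" and E: "subspace E" and P: "linear P" "range P \<subseteq> E"
    and inj: "\<And>v. v \<in> direction G \<Longrightarrow> P v = 0 \<Longrightarrow> v = 0"
    and dim: "dim (direction G) = dim E"
  obtains k :: real where "0 < k" "P \<in> lebesgue_affine G \<rightarrow>\<^sub>M lebesgue_affine E"
    "distr (lebesgue_affine G) (lebesgue_affine E) P = density (lebesgue_affine E) (\<lambda>_. ennreal k)"
proof -
  interpret P: linear P by fact
  have E': "affine E" "E \<noteq> {}" using E subspace_imp_affine subspace_0 by auto
  have E_sets: "E \<in> sets borel" using E'(1) by (intro borel_closed affine_closed)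
  obtain p B where B: "p \<in> G" "orthonormal_basis (direction G) B"
    "(\<lambda>c. p + (\<Sum>b\<in>B. c b *\<^sub>R b)) \<in> PiM B (\<lambda>_. lborel) \<rightarrow>\<^sub>M restrict_space borel G"
    "lebesgue_affine G = completion (distr (PiM B (\<lambda>_. lborel)) (restrict_space borel G)
       (\<lambda>c. p + (\<Sum>b\<in>B. c b *\<^sub>R b)))"
    using lebesgue_affine_choice[OF G] .
  obtain q C where C: "q \<in> E" "orthonormal_basis (direction E) C"
    "(\<lambda>c. q + (\<Sum>b\<in>C. c b *\<^sub>R b)) \<in> PiM C (\<lambda>_. lborel) \<rightarrow>\<^sub>M restrict_space borel E"
    "lebesgue_affine E = completion (distr (PiM C (\<lambda>_. lborel)) (restrict_space borel E)
       (\<lambda>c. q + (\<Sum>b\<in>C. c b *\<^sub>R b)))"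
    using lebesgue_affine_choice[OF E'] .
  note finB = orthonormal_basis_finite(1)[OF B(2)] and indB = orthonormal_basis_finite(2)[OF B(2)]
  note finC = orthonormal_basis_finite(1)[OF C(2)] and indC = orthonormal_basis_finite(2)[OF C(2)]
  have spanB: "span B = direction G" and spanC: "span C = E"
    using B(2) C(2) by (simp_all add: orthonormal_basis_def direction_subspace E)
  define MG where "MG = distr (PiM B (\<lambda>_. lborel)) (restrict_space borel G) (\<lambda>c. p + (\<Sum>b\<in>B. c b *\<^sub>R b))"
  define ME where "ME = distr (PiM C (\<lambda>_. lborel)) (restrict_space borel E) (\<lambda>c. q + (\<Sum>b\<in>C. c b *\<^sub>R b))"
  have inj_span: "inj_on P (span B)"
    unfolding spanB using inj direction_eq(2)[OF G(1) B(1)]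
    by (intro inj_onI) (metis P.diff eq_iff_diff_eq_0 subspace_diff)
  have injB: "inj_on P B"
    using inj_span span_superset by (rule inj_on_subset)
  have indep: "independent (P ` B)"
    using indB inj_span by (rule linear_independent_injective_image[OF P(1)])
  have "card (P ` B) = dim E"
    using card_image[OF injB] orthonormal_basis_finite(3)[OF B(2)] dim by simp
  then have "E \<subseteq> span (P ` B)"
    using indep P(2) by (intro card_ge_dim_independent) auto
  then have span: "span (P ` B) = E"
    using P(2) E by (intro antisym span_minimal) auto
  have PE: "P p \<in> E" using P(2) by auto
  have inv: "subspace_invariant (coord_measure (P p) B P) E"
    using subspace_invariant_coord_measure[OF finB injB indep] PE by (simp add: span)
  have invC: "subspace_invariant (coord_measure q C (\<lambda>b. b)) E"
    using subspace_invariant_coord_measure[of C "\<lambda>b. b" q] C(1) finC indC spanC by simp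
  obtain X where X: "X \<in> sets borel" "0 < emeasure (coord_measure q C (\<lambda>b. b)) X"
      "emeasure (coord_measure q C (\<lambda>b. b)) X < \<infinity>"
    by (rule coord_measure_positive[of C "\<lambda>b. b" q]) (use finC indC in auto)
  obtain Y where Y: "Y \<in> sets borel" "0 < emeasure (coord_measure (P p) B P) Y"
      "emeasure (coord_measure (P p) B P) Y < \<infinity>"
    using coord_measure_positive[OF finB injB indep] .
  obtain k :: real where k: "0 < k"
    "coord_measure (P p) B P = density (coord_measure q C (\<lambda>b. b)) (\<lambda>_. ennreal k)"
    using invariant_measures_proportional[OF invC inv X Y] .
  have P_borel: "P \<in> borel_measurable borel"
    by (intro borel_measurable_continuous_onI) (simp add: linear_continuous_on linear_linear P(1))
  then have "P \<in> restrict_space borel G \<rightarrow>\<^sub>M restrict_space borel E"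
    using P(2) by (intro measurable_restrict_space3) auto
  then have P_meas: "P \<in> MG \<rightarrow>\<^sub>M ME" by (simp add: MG_def ME_def)
  have "distr MG ME P = density ME (\<lambda>_. ennreal k)"
  proof (rule measure_eqI)
    fix A assume "A \<in> sets (distr MG ME P)"
    then have A: "A \<in> sets (restrict_space borel E)" "A \<in> sets ME" "A \<in> sets borel" "A \<subseteq> E"
      using E_sets by (auto simp: ME_def sets_restrict_space_iff)
    have "emeasure (distr MG ME P) A = emeasure (distr (PiM B (\<lambda>_. lborel)) ME (P \<circ> (\<lambda>c. p + (\<Sum>b\<in>B. c b *\<^sub>R b)))) A"
      using P_meas B(3) by (simp add: MG_def distr_distr)
    also have "\<dots> = emeasure (distr (PiM B (\<lambda>_. lborel)) borel (P \<circ> (\<lambda>c. p + (\<Sum>b\<in>B. c b *\<^sub>R b)))) A"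
    proof -
      have "(P \<circ> (\<lambda>c. p + (\<Sum>b\<in>B. c b *\<^sub>R b))) \<in> PiM B (\<lambda>_. lborel) \<rightarrow>\<^sub>M ME"
        using P_meas B(3) by (auto simp: MG_def intro: measurable_comp)
      moreover have "(P \<circ> (\<lambda>c. p + (\<Sum>b\<in>B. c b *\<^sub>R b))) \<in> PiM B (\<lambda>_. lborel) \<rightarrow>\<^sub>M borel"
        using P_borel coord_map_measurable[where p = p and I = B and v = "\<lambda>b. b"] by (rule measurable_comp[rotated])
      ultimately show ?thesis using A by (simp add: emeasure_distr)
    qed
    also have "\<dots> = emeasure (coord_measure (P p) B P) A"
      by (simp add: coord_measure_def comp_def P.add P.sum P.scale)
    also have "\<dots> = ennreal k * emeasure (coord_measure q C (\<lambda>b. b)) A"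
      unfolding k(2) using A by (simp add: emeasure_density_const)
    also have "\<dots> = ennreal k * emeasure ME A"
      unfolding ME_def emeasure_coord_restrict[OF C(3) E_sets A(3,4)] ..
    also have "\<dots> = emeasure (density ME (\<lambda>_. ennreal k)) A"
      using A by (simp add: emeasure_density_const)
    finally show "emeasure (distr MG ME P) A = emeasure (density ME (\<lambda>_. ennreal k)) A" .
  qed simp
  from completion_distr_density[OF P_meas this k(1)] show thesis
    using that k(1) B(4) C(4) by (simp add: MG_def ME_def)
qed

text \<open>Pushing forward multiplies the integral over the projected face by a constant
  \<open>k\<close>; for the volume the factor is the same. Hence the quotient of volumes is
  \<open>1 / k\<close>, and \<open>k\<close> never has to be computed.\<close>

lemma face_integral_projection:
  fixes F :: "'a::euclidean_space set" and P :: "'a \<Rightarrow> 'b::euclidean_space" and f :: "'b \<Rightarrow> real"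
  assumes F: "compact F" "F \<noteq> {}" "aff_dim F = int (dim E)" and E: "subspace E"
    and P: "linear P" "range P \<subseteq> E"
    and inj: "\<And>v. v \<in> direction (affine hull F) \<Longrightarrow> P v = 0 \<Longrightarrow> v = 0"
    and f: "integrable (lebesgue_affine E) f"
  shows "set_integrable (lebesgue_affine (affine hull F)) F (\<lambda>y. f (P y))"
    and "measure (lebesgue_affine E) (P ` F) / measure (lebesgue_affine (affine hull F)) F *
      (LINT y:F|lebesgue_affine (affine hull F). f (P y)) = (LINT x:P ` F|lebesgue_affine E. f x)"
proof -
  let ?G = "affine hull F"
  let ?MG = "lebesgue_affine ?G" and ?ME = "lebesgue_affine E"
  have G: "affine ?G" "?G \<noteq> {}" using F(2) by (auto simp: affine_affine_hull)
  have "dim (direction ?G) = dim E" using aff_dim_direction[OF F(2)] F(3) by simp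
  then obtain k :: real where k: "0 < k" "P \<in> ?MG \<rightarrow>\<^sub>M ?ME"
    "distr ?MG ?ME P = density ?ME (\<lambda>_. ennreal k)"
    using lebesgue_affine_linear_image[OF G E P inj] by blast
  have "compact (P ` F)"
    by (intro compact_continuous_image F(1)) (simp add: linear_continuous_on linear_linear P(1))
  then have PF_borel: "P ` F \<in> sets borel" "bounded (P ` F)" "P ` F \<subseteq> E"
    using P(2) by (auto intro: borel_compact compact_imp_bounded)
  have PF: "P ` F \<in> sets ?ME"
    using PF_borel E by (intro sets_lebesgue_affine) (auto intro: subspace_imp_affine)
  \<comment> \<open>By injectivity on the affine hull, the preimage of the projected face is the
    face itself and nothing more.\<close>
  have F_iff: "P y \<in> P ` F \<longleftrightarrow> y \<in> F" if "y \<in> ?G" for y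
  proof
    assume "P y \<in> P ` F"
    then obtain z where z: "z \<in> F" "P y = P z" by auto
    then have "y - z \<in> direction ?G" using that unfolding direction_def by (auto dest: hull_inc)
    moreover have "P (y - z) = 0" using z(2) by (simp add: linear_diff P(1))
    ultimately have "y - z = 0" by (rule inj)
    then show "y \<in> F" using z(1) by simp
  qed simp
  define g where "g x = indicator (P ` F) x * f x" for x
  have g: "integrable ?ME g"
    using integrable_mult_indicator[OF PF f] by (simp add: g_def[abs_def])
  then have g_meas: "g \<in> borel_measurable ?ME" by simp
  have g_dens: "integrable (distr ?MG ?ME P) g"
    unfolding k(3) using k(1) g by (subst integrable_density) auto
  have gP: "g (P y) = indicator F y *\<^sub>R f (P y)" if "y \<in> space ?MG" for y
    using F_iff that by (simp add: g_def indicator_def)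
  have "integrable ?MG (\<lambda>y. g (P y))"
    using integrable_distr[OF k(2) g_dens] .
  then show "set_integrable ?MG F (\<lambda>y. f (P y))"
    unfolding set_integrable_def
    by (rule Bochner_Integration.integrable_cong[OF refl gP, THEN iffD1, rotated])
  have "(LINT y:F|?MG. f (P y)) = (LINT y|?MG. g (P y))"
    unfolding set_lebesgue_integral_def by (intro Bochner_Integration.integral_cong) (auto simp: gP)
  also have "\<dots> = integral\<^sup>L (density ?ME (\<lambda>_. ennreal k)) g"
    unfolding k(3)[symmetric] using k(2) g_meas by (rule integral_distr[symmetric])
  also have "\<dots> = k * integral\<^sup>L ?ME g"
    using k(1) g_meas by (subst integral_density) auto
  also have "integral\<^sup>L ?ME g = (LINT x:P ` F|?ME. f x)"
    by (simp add: g_def[abs_def] set_lebesgue_integral_def)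
  finally have int: "(LINT y:F|?MG. f (P y)) = k * (LINT x:P ` F|?ME. f x)" .
  have "P -` (P ` F) \<inter> space ?MG = F" using F_iff by (auto dest: hull_inc)
  then have "emeasure ?MG F = emeasure (distr ?MG ?ME P) (P ` F)"
    using k(2) PF by (simp add: emeasure_distr)
  also have "\<dots> = ennreal k * emeasure ?ME (P ` F)"
    unfolding k(3) using PF by (simp add: emeasure_density_const)
  finally have vol: "measure ?MG F = k * measure ?ME (P ` F)"
    using k(1) by (simp add: measure_def enn2real_mult)
  show "measure ?ME (P ` F) / measure ?MG F * (LINT y:F|?MG. f (P y)) = (LINT x:P ` F|?ME. f x)"
  \<comment> \<open>If the projection has volume 0, both sides vanish, so positivity of the volume
    need not be shown.\<close>
  proof (cases "measure ?ME (P ` F) = 0")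
    case True
    \<comment> \<open>\<open>measure\<close> is also 0 on sets of infinite measure; boundedness
      rules this out.\<close>
    have "emeasure ?ME (P ` F) < \<infinity>"
      using emeasure_lebesgue_affine_bounded[OF E] PF_borel by blast
    with True PF have "P ` F \<in> null_sets ?ME"
      by (auto simp: measure_def null_sets_def enn2real_eq_0_iff)
    then have "AE x in ?ME. indicat_real (P ` F) x *\<^sub>R f x = 0"
      by (rule eventually_mono[OF AE_not_in]) simp
    then have "(LINT x:P ` F|?ME. f x) = 0"
      unfolding set_lebesgue_integral_def by (rule integral_eq_zero_AE)
    with True show ?thesis by simp
  next
    case False
    with k(1) show ?thesis by (simp add: int vol)
  qed
qed

section \<open>Summing the projection formula over the selected faces\<close>

theorem corollary2p8:
  fixes K E :: "(real ^ 'n) set" and d :: nat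
  assumes "polytope K" and "K \<noteq> {}"
    and "subspace E" and "dim E = d"
    and "1 \<le> d" and "d \<le> CARD('n) - 1"
  shows "\<exists>\<F>. \<F> \<subseteq> faces_of_dim d K \<and>
    (\<forall>f :: real ^ 'n \<Rightarrow> real. integrable (lebesgue_affine E) f \<longrightarrow>
       (\<forall>F\<in>\<F>. set_integrable (lebesgue_affine (affine hull F)) F (\<lambda>y. f (orth_proj E y))) \<and>
       (LINT x:orth_proj E ` K|lebesgue_affine E. f x) =
       (\<Sum>F\<in>\<F>. measure (lebesgue_affine E) (orth_proj E ` F)
                  / measure (lebesgue_affine (affine hull F)) F
                  * (LINT y:F|lebesgue_affine (affine hull F). f (orth_proj E y)))) \<and>
    measure (lebesgue_affine E) (orth_proj E ` K) =
      (\<Sum>F\<in>\<F>. measure (lebesgue_affine E) (orth_proj E ` F))"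
proof -
  let ?P = "orth_proj E" and ?M = "lebesgue_affine E"
  have P: "linear ?P" "range ?P \<subseteq> E"
    using linear_orth_proj[OF assms(3)] orth_proj(1)[OF assms(3)] by auto
  define N where "N = (\<Union>G\<in>{G. G face_of K \<and> aff_dim (?P ` G) < int (dim E)}. ?P ` G)"
  obtain \<F> where \<F>: "\<F> \<subseteq> faces_of_dim (dim E) K"
    "\<And>F v. F \<in> \<F> \<Longrightarrow> v \<in> direction (affine hull F) \<Longrightarrow> ?P v = 0 \<Longrightarrow> v = 0"
    "\<And>x. x \<in> ?P ` K \<Longrightarrow> x \<notin> N \<Longrightarrow> \<exists>!F. F \<in> \<F> \<and> x \<in> ?P ` F"
    by (rule polytope_section_faces[OF assms(1) P, folded N_def]) (rule that)
  have face: "F face_of K" if "F \<in> \<F>" for F using \<F>(1) that by (auto simp: faces_of_dim_def)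
  have fin: "finite \<F>"
    by (rule finite_subset[OF _ finite_polytope_faces[OF assms(1)]]) (use face in blast)
  have comp: "compact F" if "F face_of K" for F
    using face_of_polytope_polytope[OF assms(1) that] by (rule polytope_imp_compact)
  have P_comp: "compact (?P ` F)" if "F face_of K" for F
    by (intro compact_continuous_image comp that) (simp add: linear_continuous_on linear_linear P(1))
  have P_borel: "?P ` F \<in> sets borel" "?P ` F \<subseteq> E" "bounded (?P ` F)" if "F face_of K" for F
    using P_comp[OF that] P(2) by (auto intro: borel_compact compact_imp_bounded)
  have P_sets: "?P ` F \<in> sets ?M" if "F face_of K" for F
    using P_borel[OF that] assms(3) by (intro sets_lebesgue_affine) (auto intro: subspace_imp_affine)
  have KK: "K face_of K" using assms(1) by (simp add: face_of_refl polytope_imp_convex)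
  \<comment> \<open>There are finitely many faces, and each projection collected in \<open>N\<close>
    has dimension below \<open>dim E\<close>.\<close>
  have "N \<in> null_sets ?M"
    unfolding N_def
  proof (rule null_sets.finite_UN)
    show "finite {G. G face_of K \<and> aff_dim (?P ` G) < int (dim E)}"
      by (rule finite_subset[OF _ finite_polytope_faces[OF assms(1)]]) blast
  next
    fix G assume "G \<in> {G. G face_of K \<and> aff_dim (?P ` G) < int (dim E)}"
    then have G: "G face_of K" "aff_dim (?P ` G) < int (dim E)" by simp_all
    show "?P ` G \<in> null_sets ?M"
      by (rule null_sets_lebesgue_affine[OF assms(3) P_borel(1,2)[OF G(1)] G(2)])
  qed
  then have "AE x in ?M. x \<notin> N" by (rule AE_not_in)
  \<comment> \<open>Off \<open>N\<close> exactly one selected face projects onto a given point of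
    the projected polytope, so exactly one summand is 1.\<close>
  then have ae: "AE x in ?M. indicat_real (?P ` K) x = (\<Sum>F\<in>\<F>. indicator (?P ` F) x)"
  proof (rule eventually_mono)
    fix x assume "x \<notin> N"
    show "indicat_real (?P ` K) x = (\<Sum>F\<in>\<F>. indicator (?P ` F) x)"
    proof (cases "x \<in> ?P ` K")
      case True
      then obtain F where F: "F \<in> \<F>" "x \<in> ?P ` F" "\<And>H. H \<in> \<F> \<Longrightarrow> x \<in> ?P ` H \<Longrightarrow> H = F"
        using \<F>(3)[OF True \<open>x \<notin> N\<close>] by blast
      then have "(\<Sum>H\<in>\<F>. indicat_real (?P ` H) x) = (\<Sum>H\<in>\<F>. if H = F then 1 else 0)"
      proof (intro sum.cong refl)
        fix H assume "H \<in> \<F>"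
        then show "indicat_real (?P ` H) x = (if H = F then 1 else 0)"
          using F(2) F(3)[of H] by (cases "x \<in> ?P ` H") auto
      qed
      then show ?thesis using True F(1) fin by simp
    next
      case False
      then have "x \<notin> ?P ` F" if "F \<in> \<F>" for F
        using face_of_imp_subset[OF face[OF that]] by auto
      with False show ?thesis by simp
    qed
  qed
  have split: "(LINT x:?P ` K|?M. f x) = (\<Sum>F\<in>\<F>. LINT x:?P ` F|?M. f x)"
    if f: "integrable ?M f" for f :: "real ^ 'n \<Rightarrow> real"
  proof -
    have int: "integrable ?M (\<lambda>x. indicator (?P ` F) x * f x)" if "F face_of K" for F
      using integrable_mult_indicator[OF P_sets[OF that] f] by simp
    have "(LINT x:?P ` K|?M. f x) = (LINT x|?M. (\<Sum>F\<in>\<F>. indicator (?P ` F) x * f x))"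
      unfolding set_lebesgue_integral_def real_scaleR_def
    proof (rule integral_cong_AE)
      show "AE x in ?M. indicator (?P ` K) x * f x = (\<Sum>F\<in>\<F>. indicator (?P ` F) x * f x)"
        using ae by (rule eventually_mono) (simp add: sum_distrib_right)
    qed (use int KK face in \<open>auto intro!: borel_measurable_sum\<close>)
    also have "\<dots> = (\<Sum>F\<in>\<F>. LINT x:?P ` F|?M. f x)"
      unfolding set_lebesgue_integral_def real_scaleR_def
      using int face by (intro Bochner_Integration.integral_sum) auto
    finally show ?thesis .
  qed
  have vol: "(LINT x:?P ` F|?M. indicator (?P ` K) x) = measure ?M (?P ` F)" if "F face_of K" for F
  proof -
    have "indicat_real (?P ` F) x *\<^sub>R indicat_real (?P ` K) x = indicator (?P ` F) x" for x
      using image_mono[OF face_of_imp_subset[OF that], of ?P] by (simp add: indicator_def subset_iff)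
    then have "(LINT x:?P ` F|?M. indicator (?P ` K) x) = (LINT x|?M. indicat_real (?P ` F) x)"
      by (simp only: set_lebesgue_integral_def)
    then show ?thesis
      using P_borel(2)[OF that] by (simp add: Int_absorb2)
  qed
  \<comment> \<open>The constant function 1 is not integrable on \<open>E\<close>, so the volume
    formula uses the indicator of the projected polytope instead.\<close>
  have "integrable ?M (indicat_real (?P ` K))"
    using P_sets[OF KK] emeasure_lebesgue_affine_bounded[OF assms(3) P_borel[OF KK]]
    by (intro integrable_real_indicator) auto
  from split[OF this] have "measure ?M (?P ` K) = (\<Sum>F\<in>\<F>. measure ?M (?P ` F))"
    using vol KK face by simp
  moreover have "set_integrable (lebesgue_affine (affine hull F)) F (\<lambda>y. f (?P y))"
    "(LINT x:?P ` F|?M. f x) = measure ?M (?P ` F) / measure (lebesgue_affine (affine hull F)) F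
      * (LINT y:F|lebesgue_affine (affine hull F). f (?P y))"
    if "F \<in> \<F>" "integrable ?M f" for F and f :: "real ^ 'n \<Rightarrow> real"
  proof -
    have F: "F \<noteq> {}" "aff_dim F = int (dim E)"
      using \<F>(1) that(1) by (auto simp: faces_of_dim_def)
    note projection = face_integral_projection[OF comp[OF face[OF that(1)]] F assms(3) P \<F>(2)[OF that(1)] that(2)]
    show "set_integrable (lebesgue_affine (affine hull F)) F (\<lambda>y. f (?P y))"
      by (rule projection(1))
    show "(LINT x:?P ` F|?M. f x) = measure ?M (?P ` F) / measure (lebesgue_affine (affine hull F)) F
        * (LINT y:F|lebesgue_affine (affine hull F). f (?P y))"
      by (rule projection(2)[symmetric])
  qed
  moreover have "\<F> \<subseteq> faces_of_dim d K" using \<F>(1) assms(4) by simp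
  ultimately show ?thesis
    by (intro exI[of _ \<F>] conjI allI impI ballI) (simp_all only: split cong: sum.cong)
qed

end
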